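(* Let $\beta$ be a Pisot number, let $c\in\mathbb{Z}_{\ge1}$, let $C=\{-c,-c+1,\ldots,0,\ldots,c\}$, let $n\ge1$ and $\mathbf{C}=C^n$. If $X\subset\mathbb{R}^n$ is a finite union of compact sets belonging to the attractor of a GDIFS whose similarities are of the form $S_{\mathbf{a}}(\mathbf{x})=\frac{\mathbf{x}+\mathbf{a}}{\beta}$ for $\mathbf{a}\in\mathbf{C}$, then $X$ is $(\beta,C)$-self-similar.
   Context: A Pisot number is a real algebraic integer greater than $1$ all of whose (other) Galois conjugates have modulus less than $1$. GDIFS. A graph-directed iterated function system (GDIFS) is given by a finite directed graph $(V,E)$ (multiple edges and loops allowed) in which every vertex has at least one outgoing edge, metric spaces $(X_v,\rho_v)_{v\in V}$ and, for every edge $e$ from $u$ to $v$, a similarity $S_e:X_v\to X_u$. Here all metric spaces are $\mathbb{R}^n$ with the Euclidean distance. An attractor is a list $(K_v)_{v\in V}$ of nonempty compact sets $K_v\subset X_v$ such that for all $u\in V$, $K_u=\bigcup_{v\in V}\bigcup_{e\in E_{uv}}S_e(K_v)$, where $E_{uv}$ is the set of edges from $u$ to $v$. When all similarities have ratio less than $1$, the attractor exists and is unique. A compact set "belongs to the attractor" if it is one of the sets $K_v$. Self-similarity. For $k\in\mathbb{Z}_{\ge0}$, let $C^{<k}[\beta]$ be the set of values at $\beta$ of polynomials of degree less than $k$ with coefficients in $C$, i.e. $C^{<k}[\beta]=\{\sum_{i=0}^{k-1}u_i\beta^i\mid u_i\in C\}$ (so $C^{<0}[\beta]=\{0\}$),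 and let $\mathbf{C}^{<k}[\beta]=(C^{<k}[\beta])^n$. A compact set $X\subset\left[\frac{-c}{\beta-1},\frac{c}{\beta-1}\right]^n$ is $(\beta,C)$-self-similar if its $(\beta,C)$-kernel is finite, where the $(\beta,C)$-kernel of $X$ is the family of sets $$N_{k,\mathbf{b}}(X)=(\beta^kX-\mathbf{b})\cap\left[\frac{-c}{\beta-1},\frac{c}{\beta-1}\right]^n,\qquad k\in\mathbb{Z}_{\ge0},\ \mathbf{b}\in\mathbf{C}^{<k}[\beta].$$ *)

theory Defs
  imports
    "HOL-Analysis.Analysis"
    "HOL-Computational_Algebra.Computational_Algebra"
    "Graph_Theory.Digraph"
begin

text \<open>A monic irreducible rational polynomial with root \<open>x\<close> is the minimal polynomial of \<open>x\<close>.
  The set contains \<open>x\<close> itself if \<open>x\<close> is algebraic, and is empty otherwise.\<close>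

definition galois_conjugates :: "complex \<Rightarrow> complex set" where
  "galois_conjugates x = {z. \<exists>p :: rat poly. lead_coeff p = 1 \<and> irreducible p \<and>
     poly (map_poly of_rat p) x = 0 \<and> poly (map_poly of_rat p) z = 0}"

definition pisot :: "real \<Rightarrow> bool" where
  "pisot \<beta> \<longleftrightarrow> algebraic_int \<beta> \<and> \<beta> > 1 \<and>
     (\<forall>z \<in> galois_conjugates (of_real \<beta>) - {of_real \<beta>}. norm z < 1)"

definition similarity :: "('a::metric_space \<Rightarrow> 'b::metric_space) \<Rightarrow> bool" where
  "similarity f \<longleftrightarrow> (\<exists>r>0. \<forall>x y. dist (f x) (f y) = r * dist x y)"

text \<open>All vertices carry the same metric space. The map \<open>S e\<close> goes from the space at \<open>head G e\<close>
  to the space at \<open>tail G e\<close>. In \<open>fin_digraph\<close>, multiple arcs and loops are allowed.\<close>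

locale gdifs = fin_digraph G
  for G :: "('v, 'e) pre_digraph" (structure) +
  fixes S :: "'e \<Rightarrow> 'a::metric_space \<Rightarrow> 'a"
  assumes out_arcs_nonempty: "v \<in> verts G \<Longrightarrow> out_arcs G v \<noteq> {}"
    and similarity_arc: "e \<in> arcs G \<Longrightarrow> similarity (S e)"

definition arcs_from_to :: "('v, 'e) pre_digraph \<Rightarrow> 'v \<Rightarrow> 'v \<Rightarrow> 'e set" where
  "arcs_from_to G u v = {e \<in> arcs G. tail G e = u \<and> head G e = v}"

definition is_attractor ::
  "('v, 'e) pre_digraph \<Rightarrow> ('e \<Rightarrow> 'a \<Rightarrow> 'a) \<Rightarrow> ('v \<Rightarrow> 'a::metric_space set) \<Rightarrow> bool" where
  "is_attractor G S K \<longleftrightarrow>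
     (\<forall>v \<in> verts G. K v \<noteq> {} \<and> compact (K v)) \<and>
     (\<forall>u \<in> verts G. K u = (\<Union>v \<in> verts G. \<Union>e \<in> arcs_from_to G u v. S e ` K v))"

definition digits :: "int \<Rightarrow> real set" where
  "digits c = of_int ` {-c..c}"

definition poly_values :: "real set \<Rightarrow> nat \<Rightarrow> real \<Rightarrow> real set" where
  "poly_values C k \<beta> = {\<Sum>i<k. u i * \<beta> ^ i | u. \<forall>i<k. u i \<in> C}"

definition cart_power :: "real set \<Rightarrow> (real ^ 'n) set" where
  "cart_power A = {x. \<forall>i. x $ i \<in> A}"

definition base_cube :: "real \<Rightarrow> int \<Rightarrow> (real ^ 'n) set" where
  "base_cube \<beta> c = cart_power {- of_int c / (\<beta> - 1) .. of_int c / (\<beta> - 1)}"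

definition kernel_set :: "real \<Rightarrow> int \<Rightarrow> nat \<Rightarrow> real ^ 'n \<Rightarrow> (real ^ 'n) set \<Rightarrow> (real ^ 'n) set" where
  "kernel_set \<beta> c k b X = (\<lambda>x. \<beta> ^ k *\<^sub>R x - b) ` X \<inter> base_cube \<beta> c"

definition kernel :: "real \<Rightarrow> int \<Rightarrow> (real ^ 'n) set \<Rightarrow> (real ^ 'n) set set" where
  "kernel \<beta> c X = {kernel_set \<beta> c k b X | k b. b \<in> cart_power (poly_values (digits c) k \<beta>)}"

definition self_similar :: "real \<Rightarrow> int \<Rightarrow> (real ^ 'n) set \<Rightarrow> bool" where
  "self_similar \<beta> c X \<longleftrightarrow> compact X \<and> X \<subseteq> base_cube \<beta> c \<and> finite (kernel \<beta> c X)"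

end

theory Submission
  imports Defs
begin

text \<open>Iterating the attractor equation \<open>k\<close> times and rescaling by \<open>\<beta> ^ k\<close> writes \<open>\<beta> ^ k K\<^sub>u\<close> as a union
  of translates \<open>K\<^sub>v + w\<close>, one for every path of length \<open>k\<close> from \<open>u\<close> to some \<open>v\<close>, where the coordinates
  of \<open>w\<close> are values at \<open>\<beta>\<close> of polynomials of degree less than \<open>k\<close> with digits as coefficients
  (\<open>attractor_unfold\<close>). Hence every kernel set is a union of pieces \<open>(K\<^sub>v + (w - b)) \<inter> cube\<close>. All
  \<open>K\<^sub>v\<close> lie in the base cube (\<open>attractor_subset_base_cube\<close>), so a piece can be nonempty only if the
  coordinates of \<open>w - b\<close> are at most twice the half side of the cube. The kernel is then finite
  as soon as only finitely many translations \<open>w - b\<close> are that small.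

  The arithmetic of \<open>\<beta>\<close> enters here, through a lemma of Garsia
  (\<open>pisot_finite_bounded_poly_values\<close>): for a Pisot number \<open>\<beta>\<close>, only finitely many numbers in a
  bounded interval have the form \<open>f(\<beta>)\<close> with \<open>f\<close> an integer polynomial of arbitrary degree
  whose coefficients are at most \<open>D\<close> in absolute value. Let \<open>q\<close> be the minimal polynomial of \<open>\<beta>\<close>
  over the rationals and \<open>r = f mod q\<close>, so that \<open>f(\<beta>) = r(\<beta>)\<close>. At a conjugate \<open>z \<noteq> \<beta>\<close> the value
  \<open>r(z) = f(z)\<close> is bounded by a geometric series because \<open>|z| < 1\<close>, and at \<open>\<beta>\<close> it is bounded by
  assumption. Since \<open>q\<close> has as many distinct roots as its degree, Lagrange interpolation bounds the
  coefficients of \<open>r\<close> (\<open>coeff_bound_from_values\<close>). Since \<open>\<beta>\<close> is an algebraic integer, these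
  coefficients have a common denominator that does not depend on \<open>f\<close>
  (\<open>bounded_denominator_of_powers_mod\<close>). Bounded rationals with a fixed denominator are finite in
  number, and therefore so are the possible \<open>r\<close>.\<close>

(* From here on, x $ i is a component of a vector, not a coefficient of a power series. *)
unbundle no fps_syntax

section \<open>Rational polynomials evaluated in fields of characteristic zero\<close>

lemma poly_of_rat_add:
  "poly (map_poly of_rat (p + q)) (z :: 'a :: field_char_0) =
     poly (map_poly of_rat p) z + poly (map_poly of_rat q) z"
  by (induction p q rule: poly_induct2) (auto simp: map_poly_pCons of_rat_add algebra_simps)

lemma poly_of_rat_smult:
  "poly (map_poly of_rat (smult a p)) (z :: 'a :: field_char_0) =
     of_rat a * poly (map_poly of_rat p) z"
  by (simp add: map_poly_smult of_rat_mult)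

lemma poly_of_rat_mult:
  "poly (map_poly of_rat (p * q)) (z :: 'a :: field_char_0) =
     poly (map_poly of_rat p) z * poly (map_poly of_rat q) z"
  by (induction p) (auto simp: map_poly_pCons poly_of_rat_add poly_of_rat_smult algebra_simps)

lemma poly_of_rat_sum:
  "poly (map_poly of_rat (\<Sum>i\<in>A. f i)) (z :: 'a :: field_char_0) =
     (\<Sum>i\<in>A. poly (map_poly of_rat (f i)) z)"
  by (induction A rule: infinite_finite_induct) (auto simp: poly_of_rat_add)

lemma poly_of_rat_mod:
  assumes "poly (map_poly of_rat q) (z :: 'a :: field_char_0) = 0"
  shows "poly (map_poly of_rat (p mod q)) z = poly (map_poly of_rat p) z"
proof -
  have "poly (map_poly of_rat p) z = poly (map_poly of_rat (p div q * q + p mod q)) z"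
    by simp
  then show ?thesis
    unfolding poly_of_rat_add poly_of_rat_mult assms by simp
qed

lemma poly_of_rat_monom_1:
  "poly (map_poly of_rat (monom 1 k)) (z :: 'a :: field_char_0) = z ^ k"
  by (simp add: map_poly_monom poly_monom)

lemma of_real_of_rat: "complex_of_real (of_rat a) = of_rat a"
proof -
  obtain m n where "quotient_of a = (m, n)" by fastforce
  then have "a = of_int m / of_int n" by (rule quotient_of_div)
  then show ?thesis by (simp add: of_rat_divide)
qed

lemma poly_of_rat_of_real:
  "poly (map_poly of_rat p) (complex_of_real x) = of_real (poly (map_poly of_rat p) x)"
  by (induction p) (auto simp: map_poly_pCons of_real_of_rat)

section \<open>Minimal polynomials\<close>

lemma exists_minimal_polynomial:
  fixes z :: "'a :: field_char_0"
  assumes "f \<noteq> 0" "poly (map_poly of_rat f) z = 0"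
  obtains q where "lead_coeff q = 1" "irreducible q" "poly (map_poly of_rat q) z = 0"
    "\<And>g. poly (map_poly of_rat g) z = 0 \<Longrightarrow> q dvd g"
proof -
  \<comment> \<open>A nonzero polynomial of least degree among those vanishing at \<open>z\<close>, made monic.\<close>
  define P where "P = (\<lambda>q :: rat poly. q \<noteq> 0 \<and> poly (map_poly of_rat q) z = 0)"
  have "P f" using assms by (simp add: P_def)
  define q0 where "q0 = (ARG_MIN degree q. P q)"
  have q0: "P q0" and min0: "\<And>r. P r \<Longrightarrow> degree q0 \<le> degree r"
    using arg_min_nat_lemma[of P f degree] \<open>P f\<close> unfolding q0_def by auto
  define q where "q = smult (inverse (lead_coeff q0)) q0"
  have lc: "lead_coeff q = 1" and Pq: "P q"
    using q0 by (auto simp: q_def P_def poly_of_rat_smult)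
  have min: "degree q \<le> degree r" if "P r" for r
    using min0[OF that] by (simp add: q_def)
  have q_ne: "q \<noteq> 0" and q_root: "poly (map_poly of_rat q) z = 0"
    using Pq by (auto simp: P_def)
  have deg_pos: "degree q > 0"
  proof (rule ccontr)
    assume "\<not> degree q > 0"
    then obtain a where "q = [:a:]" using degree_eq_zeroE by blast
    with q_ne q_root show False by (simp add: map_poly_pCons)
  qed
  have "irreducible q"
  proof (rule irreducibleI)
    show "q \<noteq> 0" by fact
    show "\<not> q dvd 1" using deg_pos by (auto simp: is_unit_iff_degree q_ne)
  next
    fix a b assume ab: "q = a * b"
    then have ne: "a \<noteq> 0" "b \<noteq> 0" using q_ne by auto
    have deg: "degree q = degree a + degree b" using ab ne by (simp add: degree_mult_eq)
    have "poly (map_poly of_rat a) z = 0 \<or> poly (map_poly of_rat b) z = 0"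
      using q_root by (simp add: ab poly_of_rat_mult)
    then have "degree q \<le> degree a \<or> degree q \<le> degree b"
      using min[of a] min[of b] ne by (auto simp: P_def)
    then show "a dvd 1 \<or> b dvd 1"
      using deg ne by (auto simp: is_unit_iff_degree)
  qed
  moreover have "q dvd g" if g: "poly (map_poly of_rat g) z = 0" for g
  proof (rule ccontr)
    assume "\<not> q dvd g"
    then have "g mod q \<noteq> 0" by (simp add: dvd_eq_mod_eq_0)
    then have "P (g mod q)" "degree (g mod q) < degree q"
      using g q_root degree_mod_less[OF q_ne, of g] by (auto simp: P_def poly_of_rat_mod)
    then show False using min by fastforce
  qed
  ultimately show ?thesis using that lc q_root by blast
qed

text \<open>Irreducible polynomials are separable in characteristic zero: the minimal polynomial of a common
  root of \<open>q\<close> and \<open>pderiv q\<close> would be associated with \<open>q\<close>, and \<open>q\<close> would then divide its derivative,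
  which has smaller degree.\<close>

lemma irreducible_rat_poly_card_roots:
  fixes q :: "rat poly"
  assumes "irreducible q"
  shows "finite {z :: complex. poly (map_poly of_rat q) z = 0}"
    and "card {z :: complex. poly (map_poly of_rat q) z = 0} = degree q"
proof -
  let ?h = "map_poly of_rat :: rat poly \<Rightarrow> complex poly"
  have q_ne: "q \<noteq> 0" and deg: "degree q > 0"
    using assms by (auto simp: irreducible_def is_unit_iff_degree)
  have deg_h: "degree (?h q) = degree q" by (simp add: degree_map_poly)
  have h_ne: "?h q \<noteq> 0" using deg deg_h by auto
  have "\<not> q dvd pderiv q"
    using deg by (auto dest!: dvd_imp_degree_le simp: degree_pderiv pderiv_eq_0_iff)
  have pd: "pderiv (?h q) = ?h (pderiv q)"
    by (rule poly_eqI) (simp add: coeff_pderiv coeff_map_poly of_rat_mult of_rat_add)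
  have "rsquarefree (?h q)"
    unfolding rsquarefree_roots
  proof (intro allI notI)
    fix z assume z: "poly (?h q) z = 0 \<and> poly (pderiv (?h q)) z = 0"
    then obtain m where m: "irreducible m" "m dvd q" "m dvd pderiv q"
      using exists_minimal_polynomial[OF q_ne, of z] pd by metis
    from m(2) obtain h where h: "q = m * h" by (rule dvdE)
    have "\<not> is_unit m" using m(1) by (simp add: irreducible_def)
    then have "is_unit h" using irreducibleD[OF assms h] by blast
    then have "q dvd m" by (simp add: h mult_unit_dvd_iff)
    then show False using m(3) \<open>\<not> q dvd pderiv q\<close> dvd_trans by blast
  qed
  then have dec: "smult (lead_coeff (?h q)) (\<Prod>z | poly (?h q) z = 0. [:- z, 1:]) = ?h q"
    by (rule complex_poly_decompose_rsquarefree)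
  show fin: "finite {z :: complex. poly (?h q) z = 0}"
    using h_ne by (rule poly_roots_finite)
  have "degree (?h q) = degree (\<Prod>z | poly (?h q) z = 0. [:- z, 1:])"
    by (subst dec[symmetric]) (use h_ne in simp)
  also have "\<dots> = card {z. poly (?h q) z = 0}"
    by (subst degree_prod_eq_sum_degree) auto
  finally show "card {z :: complex. poly (?h q) z = 0} = degree q"
    using deg_h by simp
qed

section \<open>Finiteness of polynomials with bounded values and denominators\<close>

text \<open>Lagrange interpolation: \<open>r\<close> is a linear combination, with coefficients \<open>poly r z\<close>, of fixed
  polynomials that depend on \<open>Z\<close> alone.\<close>

lemma coeff_bound_from_values:
  fixes Z :: "'a :: real_normed_field set"
  assumes "finite Z"
  obtains A where "\<And>r B i. degree r < card Z \<Longrightarrow> (\<And>z. z \<in> Z \<Longrightarrow> norm (poly r z) \<le> B)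
    \<Longrightarrow> norm (coeff r i) \<le> A i * B"
proof -
  define L where "L = (\<lambda>z. smult (inverse (\<Prod>w\<in>Z-{z}. z - w)) (\<Prod>w\<in>Z-{z}. [:- w, 1:]))"
  have L_eval: "poly (L z) w = (if w = z then 1 else 0)" if "z \<in> Z" "w \<in> Z" for z w
    using that assms by (auto simp: L_def poly_prod)
  have L_deg: "degree (L z) < card Z" if "z \<in> Z" for z
  proof -
    have "degree (L z) \<le> degree (\<Prod>w\<in>Z-{z}. [:- w, 1:])"
      unfolding L_def by (rule degree_smult_le)
    also have "\<dots> = card (Z - {z})" by (subst degree_prod_eq_sum_degree) auto
    also have "\<dots> < card Z" using assms that by (intro psubset_card_mono) auto
    finally show ?thesis .
  qed
  show ?thesis
  proof (rule that)
    fix r B i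
    assume deg: "degree r < card Z" and B: "\<And>z. z \<in> Z \<Longrightarrow> norm (poly r z) \<le> B"
    have "r = (\<Sum>z\<in>Z. smult (poly r z) (L z))"
    proof (rule poly_eqI_degree[of Z])
      fix w assume w: "w \<in> Z"
      have "poly (\<Sum>z\<in>Z. smult (poly r z) (L z)) w = (\<Sum>z\<in>Z. if w = z then poly r z else 0)"
        unfolding poly_sum by (intro sum.cong) (auto simp: L_eval w)
      then show "poly r w = poly (\<Sum>z\<in>Z. smult (poly r z) (L z)) w"
        using assms w by simp
    next
      show "degree (\<Sum>z\<in>Z. smult (poly r z) (L z)) < card Z"
        using deg L_deg by (intro degree_sum_less) (auto intro: le_less_trans[OF degree_smult_le])
    qed (use deg in auto)
    then have "coeff r i = (\<Sum>z\<in>Z. poly r z * coeff (L z) i)"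
      by (metis (no_types, lifting) coeff_smult coeff_sum sum.cong)
    also have "norm \<dots> \<le> (\<Sum>z\<in>Z. B * norm (coeff (L z) i))"
      by (rule sum_norm_le) (auto simp: norm_mult intro!: mult_right_mono B)
    finally show "norm (coeff r i) \<le> (\<Sum>z\<in>Z. norm (coeff (L z) i)) * B"
      by (simp add: sum_distrib_left mult.commute)
  qed
qed

lemma common_denominator:
  fixes A :: "rat set"
  assumes "finite A"
  obtains N :: int where "N > 0" "\<And>x. x \<in> A \<Longrightarrow> of_int N * x \<in> \<int>"
proof -
  have "\<exists>N :: int. N > 0 \<and> (\<forall>x\<in>A. of_int N * x \<in> \<int>)"
    using assms
  proof induction
    case (insert x A)
    then obtain N :: int where N: "N > 0" "\<forall>x\<in>A. of_int N * x \<in> \<int>" by blast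
    obtain a b where "quotient_of x = (a, b)" by fastforce
    then have x: "x = of_int a / of_int b" "b > 0"
      by (auto intro: quotient_of_div quotient_of_denom_pos)
    then have "of_int b * x = of_int a" by simp
    then have "of_int (N * b) * x = of_int (N * a)"
      by simp
    then have "of_int (N * b) * x \<in> \<int>" by (metis Ints_of_int)
    moreover have "of_int (N * b) * y \<in> \<int>" if "y \<in> A" for y
    proof -
      have "of_int (N * b) * y = of_int b * (of_int N * y)" by simp
      then show ?thesis using N that by (metis Ints_mult Ints_of_int)
    qed
    ultimately show ?case using N x by (intro exI[of _ "N * b"]) auto
  qed (auto intro: exI[of _ 1])
  then show ?thesis using that by blast
qed

lemma poly_mod_sum_left: "(\<Sum>i\<in>A. f i) mod q = (\<Sum>i\<in>A. f i mod (q :: 'a :: field poly))"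
  by (induction A rule: infinite_finite_induct) (auto simp: poly_mod_add_left)

text \<open>Modulo \<open>q\<close>, the monic integer polynomial \<open>p\<close> expresses the monomial of degree \<open>k \<ge> degree p\<close> as
  an integer combination of monomials of smaller degree. So a common denominator for the residues
  of the first \<open>degree p\<close> monomials serves for all of them. (By Gauss's lemma it could be taken
  to be \<open>1\<close>, but a bound suffices to count residues.)\<close>

lemma bounded_denominator_of_powers_mod:
  fixes q :: "rat poly" and p :: "int poly"
  assumes "lead_coeff p = 1" and "q dvd map_poly of_int p"
  obtains N :: int where "N > 0" "\<And>k i. of_int N * coeff (monom 1 k mod q) i \<in> \<int>"
proof -
  let ?f = "map_poly of_int p :: rat poly"
  define d where "d = degree p"
  define A where "A = (\<Union>k<d. (\<lambda>i. coeff (monom 1 k mod q) i) ` {..degree (monom 1 k mod q)})"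
  have "finite A" by (auto simp: A_def)
  then obtain N :: int where N: "N > 0" "\<And>x. x \<in> A \<Longrightarrow> of_int N * x \<in> \<int>"
    using common_denominator by metis
  have "of_int N * coeff (monom 1 k mod q) i \<in> \<int>" for k i
  proof (induction k arbitrary: i rule: less_induct)
    case (less k)
    show ?case
    proof (cases "k < d")
      case True
      show ?thesis
      proof (cases "i \<le> degree (monom 1 k mod q)")
        case le: True
        then show ?thesis using True by (intro N) (auto simp: A_def)
      next
        case False
        then show ?thesis by (simp add: coeff_eq_0)
      qed
    next
      case False
      have "?f = (\<Sum>i\<le>d. monom (coeff ?f i) i)"
        using poly_as_sum_of_monoms[of ?f] by (simp add: d_def degree_map_poly)
      also have "\<dots> = monom 1 d + (\<Sum>i<d. monom (coeff ?f i) i)"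
        using assms(1) by (simp add: d_def lessThan_Suc_atMost[symmetric] coeff_map_poly)
      finally have "monom 1 d = ?f - (\<Sum>i<d. monom (coeff ?f i) i)"
        by (simp add: algebra_simps)
      then have "monom 1 (k - d) * monom 1 d = monom 1 (k - d) * ?f
          - (\<Sum>i<d. smult (of_int (coeff p i)) (monom 1 (k - d + i)))"
        by (simp add: right_diff_distrib sum_distrib_left mult_monom smult_monom coeff_map_poly)
      moreover have "monom 1 (k - d) * monom 1 d = (monom 1 k :: rat poly)"
        using False by (simp add: mult_monom)
      ultimately have "monom 1 k mod q = (monom 1 (k - d) * ?f) mod q
          - (\<Sum>i<d. smult (of_int (coeff p i)) (monom 1 (k - d + i) mod q))"
        by (simp add: poly_mod_diff_left poly_mod_sum_left mod_smult_left)
      moreover have "(monom 1 (k - d) * ?f) mod q = 0"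
        using assms(2) by (simp add: mod_eq_0_iff_dvd)
      ultimately have "of_int N * coeff (monom 1 k mod q) i =
          - (\<Sum>j<d. of_int (coeff p j) * (of_int N * coeff (monom 1 (k - d + j) mod q) i))"
        by (simp add: coeff_sum sum_distrib_left mult.left_commute)
      also have "\<dots> \<in> \<int>"
        using False by (intro Ints_minus Ints_sum Ints_mult Ints_of_int less.IH) auto
      finally show ?thesis .
    qed
  qed
  with N show ?thesis using that by blast
qed

lemma finite_bounded_rats_with_denominator:
  assumes "N > 0"
  shows "finite {x :: rat. of_int N * x \<in> \<int> \<and> \<bar>real_of_rat x\<bar> \<le> B}"
proof (rule finite_subset)
  show "{x :: rat. of_int N * x \<in> \<int> \<and> \<bar>real_of_rat x\<bar> \<le> B}
      \<subseteq> (\<lambda>j. of_int j / of_int N) ` {- \<lceil>of_int N * B\<rceil>..\<lceil>of_int N * B\<rceil>}"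
  proof clarify
    fix x :: rat assume "of_int N * x \<in> \<int>" and B: "\<bar>real_of_rat x\<bar> \<le> B"
    then obtain j where j: "of_int N * x = of_int j" by (auto elim: Ints_cases)
    then have x: "x = of_int j / of_int N" using assms by (simp add: field_simps)
    have "real_of_int j = of_int N * real_of_rat x"
      using assms by (simp add: x of_rat_divide)
    then have "\<bar>real_of_int j\<bar> \<le> of_int N * B"
      using assms B by (simp add: abs_mult)
    then have "j \<in> {- \<lceil>of_int N * B\<rceil>..\<lceil>of_int N * B\<rceil>}" unfolding atLeastAtMost_iff by linarith
    with x show "x \<in> (\<lambda>j. of_int j / of_int N) ` {- \<lceil>of_int N * B\<rceil>..\<lceil>of_int N * B\<rceil>}"
      by (rule image_eqI)
  qed
qed simp

lemma finite_polys_degree_less: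
  assumes "\<And>i. i < m \<Longrightarrow> finite (A i)"
  shows "finite {p. degree p < m \<and> (\<forall>i. coeff p i \<in> A i)}"
proof (rule finite_subset)
  let ?L = "{xs. set xs \<subseteq> (\<Union>i<m. A i) \<and> length xs = m}"
  show "{p. degree p < m \<and> (\<forall>i. coeff p i \<in> A i)} \<subseteq> Poly ` ?L"
  proof clarify
    fix p assume p: "degree p < m" "\<forall>i. coeff p i \<in> A i"
    have "p = Poly (map (coeff p) [0..<m])"
      using p(1) by (intro poly_eqI) (auto simp: coeff_Poly_eq nth_default_def coeff_eq_0)
    then show "p \<in> Poly ` ?L" by (rule image_eqI) (use p(2) in auto)
  qed
  show "finite (Poly ` ?L)"
    using assms by (intro finite_imageI finite_lists_length_eq) auto
qed

lemma norm_power_sum_le: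
  fixes z :: "'a :: real_normed_field"
  assumes "norm z < 1" and "\<And>i. i < k \<Longrightarrow> norm (d i) \<le> D" and "D \<ge> 0"
  shows "norm (\<Sum>i<k. d i * z ^ i) \<le> D / (1 - norm z)"
proof -
  have "norm (\<Sum>i<k. d i * z ^ i) \<le> (\<Sum>i<k. D * norm z ^ i)"
    by (rule sum_norm_le) (auto simp: norm_mult norm_power intro!: mult_right_mono assms)
  also have "\<dots> = D * (\<Sum>i<k. norm z ^ i)" by (simp add: sum_distrib_left)
  also have "\<dots> \<le> D * (1 / (1 - norm z))"
  proof (rule mult_left_mono)
    have "(\<Sum>i<k. norm z ^ i) \<le> (\<Sum>i. norm z ^ i)"
      using assms(1) by (intro sum_le_suminf) (auto intro: summable_geometric)
    then show "(\<Sum>i<k. norm z ^ i) \<le> 1 / (1 - norm z)"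
      using assms(1) by (simp add: suminf_geometric)
  qed fact
  finally show ?thesis by simp
qed

section \<open>Garsia's lemma for Pisot numbers\<close>

text \<open>The values at \<open>\<beta>\<close> are unchanged when polynomials are reduced modulo the minimal polynomial \<open>q\<close>
  of \<open>\<beta>\<close>, and the residues that occur form a finite set: their degree is bounded by that of \<open>q\<close>, their
  denominators by integrality of \<open>\<beta>\<close>, and their size by their values at the conjugates.\<close>

proposition pisot_finite_bounded_poly_values:
  assumes "pisot \<beta>"
  shows "finite {x \<in> (\<Union>k. poly_values (digits D) k \<beta>). \<bar>x\<bar> \<le> M}"
proof (cases "D \<ge> 0")
  case False
  then have "digits D = {}" by (simp add: digits_def)
  then have "{x \<in> (\<Union>k. poly_values (digits D) k \<beta>). \<bar>x\<bar> \<le> M} \<subseteq> {0}"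
    by (fastforce simp: poly_values_def intro!: sum.neutral)
  then show ?thesis by (rule finite_subset) simp
next
  case True
  obtain p :: "int poly" where p: "poly (map_poly of_int p) \<beta> = 0" "lead_coeff p = 1"
    using assms unfolding pisot_def algebraic_int_altdef_ipoly by blast
  let ?f = "map_poly of_int p :: rat poly"
  have "map_poly of_rat ?f = (map_poly of_int p :: real poly)"
    by (rule poly_eqI) (simp add: coeff_map_poly)
  moreover have "?f \<noteq> 0"
    using p(2) by (metis coeff_0 coeff_map_poly of_int_0 of_int_1 zero_neq_one)
  ultimately obtain q where q: "lead_coeff q = 1" "irreducible q"
      "poly (map_poly of_rat q) \<beta> = 0" "q dvd ?f"
    using exists_minimal_polynomial[of ?f \<beta>] p(1) by metis
  define Z where "Z = {z :: complex. poly (map_poly of_rat q) z = 0}"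
  have Z: "finite Z" "card Z = degree q"
    unfolding Z_def using irreducible_rat_poly_card_roots[OF q(2)] by auto
  have Z_small: "norm z < 1" if "z \<in> Z" "z \<noteq> of_real \<beta>" for z
  proof -
    have "z \<in> galois_conjugates (of_real \<beta>)"
      using q that unfolding galois_conjugates_def Z_def
      by (auto simp: poly_of_rat_of_real intro!: exI[of _ q])
    then show ?thesis using assms that unfolding pisot_def by blast
  qed
  obtain N :: int where N: "N > 0" "\<And>k i. of_int N * coeff (monom 1 k mod q) i \<in> \<int>"
    using bounded_denominator_of_powers_mod[OF p(2) q(4)] by blast
  obtain A where A: "\<And>r B i. degree r < card Z \<Longrightarrow> (\<And>z. z \<in> Z \<Longrightarrow> norm (poly r z) \<le> B)
      \<Longrightarrow> norm (coeff r i) \<le> A i * B"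
    using coeff_bound_from_values[OF Z(1)] by blast
  \<comment> \<open>A bound valid at all conjugates: \<open>M\<close> at \<open>\<beta>\<close> itself, a geometric series at the others.\<close>
  define B where "B = Max (insert M ((\<lambda>z. of_int D / (1 - norm z)) ` Z))"
  have B: "M \<le> B" "\<And>z. z \<in> Z \<Longrightarrow> of_int D / (1 - norm z) \<le> B"
    using Z(1) by (auto simp: B_def intro!: Max_ge)
  define R where "R = {r :: rat poly. degree r < degree q \<and>
      (\<forall>i. coeff r i \<in> {x. of_int N * x \<in> \<int> \<and> \<bar>real_of_rat x\<bar> \<le> A i * B})}"
  have "finite R"
    unfolding R_def by (intro finite_polys_degree_less finite_bounded_rats_with_denominator N)
  have deg_q: "degree q > 0" and q_ne: "q \<noteq> 0"
    using q(2) by (auto simp: irreducible_def is_unit_iff_degree)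
  have "x \<in> (\<lambda>r. poly (map_poly of_rat r) \<beta>) ` R"
    if x: "x \<in> poly_values (digits D) k \<beta>" and M: "\<bar>x\<bar> \<le> M" for x k
  proof -
    obtain u where u: "\<And>i. i < k \<Longrightarrow> u i \<in> digits D" "x = (\<Sum>i<k. u i * \<beta> ^ i)"
      using x unfolding poly_values_def by blast
    then have "\<forall>i\<in>{..<k}. \<exists>d. u i = of_int d \<and> \<bar>d\<bar> \<le> D"
      by (fastforce simp: digits_def abs_le_iff)
    then obtain d where d: "\<And>i. i < k \<Longrightarrow> u i = of_int (d i) \<and> \<bar>d i\<bar> \<le> D" by (metis lessThan_iff)
    \<comment> \<open>The residue modulo \<open>q\<close> of the polynomial whose value at \<open>\<beta>\<close> is \<open>x\<close>.\<close>
    define r where "r = (\<Sum>i<k. smult (of_int (d i)) (monom 1 i mod q))"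
    have r_eval: "poly (map_poly of_rat r) z = (\<Sum>i<k. of_int (d i) * z ^ i)"
      if "poly (map_poly of_rat q) z = 0" for z :: "'b :: field_char_0"
      using that unfolding r_def
      by (simp add: poly_of_rat_sum poly_of_rat_smult poly_of_rat_mod poly_of_rat_monom_1)
    have mod_deg: "degree (g mod q) < degree q" for g
      using degree_mod_less[OF q_ne, of g] deg_q by auto
    have deg_r: "degree r < degree q"
      unfolding r_def using deg_q
      by (intro degree_sum_less)
         (auto intro!: le_less_trans[OF degree_smult_le] mod_deg)
    have r_beta: "poly (map_poly of_rat r) \<beta> = x"
      using r_eval[OF q(3)] u d by simp
    have "norm (poly (map_poly of_rat r) z) \<le> B" if z: "z \<in> Z" for z :: complex
    proof (cases "z = of_real \<beta>")
      case True
      then show ?thesis using r_beta M B by (simp add: poly_of_rat_of_real)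
    next
      case False
      have "real_of_int \<bar>d i\<bar> \<le> of_int D" if "i < k" for i
        using d[OF that] by (simp only: of_int_le_iff)
      then have "norm (\<Sum>i<k. of_int (d i) * z ^ i) \<le> of_int D / (1 - norm z)"
        using Z_small[OF z False] True \<open>D \<ge> 0\<close> by (intro norm_power_sum_le) auto
      then show ?thesis using r_eval[of z] z B(2)[OF z] by (auto simp: Z_def)
    qed
    then have coeff_le: "norm (coeff (map_poly of_rat r :: complex poly) i) \<le> A i * B" for i
      using deg_r Z(2) by (intro A) (auto simp: degree_map_poly)
    have "\<bar>real_of_rat (coeff r i)\<bar> \<le> A i * B" for i
      using coeff_le[of i] by (simp add: coeff_map_poly flip: of_real_of_rat)
    moreover have "of_int N * coeff r i \<in> \<int>" for i
    proof -
      have "of_int N * coeff r i = (\<Sum>j<k. of_int (d j) * (of_int N * coeff (monom 1 j mod q) i))"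
        by (simp add: r_def coeff_sum sum_distrib_left mult.left_commute)
      also have "\<dots> \<in> \<int>" by (intro Ints_sum Ints_mult Ints_of_int N)
      finally show ?thesis .
    qed
    ultimately have "r \<in> R" using deg_r by (simp add: R_def)
    then show ?thesis using r_beta by blast
  qed
  then have "{x \<in> (\<Union>k. poly_values (digits D) k \<beta>). \<bar>x\<bar> \<le> M}
      \<subseteq> (\<lambda>r. poly (map_poly of_rat r) \<beta>) ` R" by blast
  then show ?thesis using \<open>finite R\<close> by (meson finite_imageI finite_subset)
qed

section \<open>Digit polynomials and the coordinate cube\<close>

lemma finite_cart_power:
  assumes "finite A"
  shows "finite (cart_power A :: (real ^ 'n) set)"
proof (rule finite_subset)
  show "(cart_power A :: (real ^ 'n) set) \<subseteq> vec_lambda ` (UNIV \<rightarrow>\<^sub>E A)"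
  proof
    fix x :: "real ^ 'n" assume "x \<in> cart_power A"
    then have "x = vec_lambda (vec_nth x)" "vec_nth x \<in> UNIV \<rightarrow>\<^sub>E A"
      by (auto simp: cart_power_def)
    then show "x \<in> vec_lambda ` (UNIV \<rightarrow>\<^sub>E A)" by blast
  qed
  show "finite (vec_lambda ` (UNIV \<rightarrow>\<^sub>E A) :: (real ^ 'n) set)"
    using assms by (intro finite_imageI finite_PiE) auto
qed

lemma poly_values_diff:
  assumes "x \<in> poly_values (digits c) k \<beta>" "y \<in> poly_values (digits d) k \<beta>"
  shows "x - y \<in> poly_values (digits (c + d)) k \<beta>"
proof -
  obtain u v where u: "\<forall>i<k. u i \<in> digits c" "x = (\<Sum>i<k. u i * \<beta> ^ i)"
    and v: "\<forall>i<k. v i \<in> digits d" "y = (\<Sum>i<k. v i * \<beta> ^ i)"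
    using assms unfolding poly_values_def by blast
  have "u i - v i \<in> digits (c + d)" if "i < k" for i
  proof -
    have "u i \<in> digits c" "v i \<in> digits d" using u(1) v(1) that by auto
    then obtain m n where "u i = of_int m" "v i = of_int n" "m \<in> {-c..c}" "n \<in> {-d..d}"
      unfolding digits_def by blast
    then show ?thesis
      unfolding digits_def by (intro image_eqI[of _ _ "m - n"]) auto
  qed
  moreover have "x - y = (\<Sum>i<k. (u i - v i) * \<beta> ^ i)"
    by (simp add: u v sum_subtractf left_diff_distrib)
  ultimately show ?thesis unfolding poly_values_def by auto
qed

lemma poly_values_Suc:
  assumes "a \<in> C" "w \<in> poly_values C k \<beta>"
  shows "a + \<beta> * w \<in> poly_values C (Suc k) \<beta>"
proof -
  obtain u where u: "\<forall>i<k. u i \<in> C" "w = (\<Sum>i<k. u i * \<beta> ^ i)"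
    using assms(2) unfolding poly_values_def by blast
  have "a + \<beta> * w = (\<Sum>i<Suc k. case_nat a u i * \<beta> ^ i)"
    by (simp add: u(2) sum.lessThan_Suc_shift sum_distrib_left mult_ac del: sum.lessThan_Suc)
  moreover have "\<forall>i<Suc k. case_nat a u i \<in> C"
    using assms(1) u(1) by (auto split: nat.split)
  ultimately show ?thesis unfolding poly_values_def by blast
qed

section \<open>Attractors of systems with digit translations\<close>

text \<open>The attractor equation is used in inverted form: instead of the contractions
  \<open>x \<mapsto> (x + a e) / \<beta>\<close>, the assumption \<open>mem_attractor_iff\<close> follows a point under the
  expanding maps \<open>x \<mapsto> \<beta> x - a e\<close>. Iterating it yields directly the rescaled points \<open>\<beta> ^ k x - w\<close> that
  define the kernel sets.\<close>

locale digit_attractor = fin_digraph G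
  for G :: "('v, 'e) pre_digraph" (structure) +
  fixes \<beta> :: real and c :: int and a :: "'e \<Rightarrow> real ^ 'n" and K :: "'v \<Rightarrow> (real ^ 'n) set"
  assumes beta_gt_1: "\<beta> > 1"
    and translation: "e \<in> arcs G \<Longrightarrow> a e \<in> cart_power (digits c)"
    and compact_attractor: "v \<in> verts G \<Longrightarrow> compact (K v)"
    and mem_attractor_iff: "u \<in> verts G \<Longrightarrow>
      x \<in> K u \<longleftrightarrow> (\<exists>e \<in> arcs G. tail G e = u \<and> \<beta> *\<^sub>R x - a e \<in> K (head G e))"
begin

text \<open>Let \<open>m\<close> be the maximum of an absolute coordinate over all the sets \<open>K v\<close>. The point attaining it
  has an expanded image in some \<open>K v\<close>, whence \<open>\<beta> m - c \<le> m\<close>, that is \<open>m \<le> c / (\<beta> - 1)\<close>.\<close>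

lemma attractor_subset_base_cube:
  assumes "v \<in> verts G"
  shows "K v \<subseteq> base_cube \<beta> c"
proof
  fix x assume x: "x \<in> K v"
  let ?W = "\<Union>v\<in>verts G. K v"
  have "\<bar>x $ i\<bar> \<le> of_int c / (\<beta> - 1)" for i
  proof -
    have "compact ?W" using compact_attractor by (intro compact_UN) auto
    moreover have "?W \<noteq> {}" using x assms by blast
    moreover have "continuous_on ?W (\<lambda>x. \<bar>x $ i\<bar>)" by (intro continuous_intros)
    ultimately obtain y where y: "y \<in> ?W" and max: "\<And>z. z \<in> ?W \<Longrightarrow> \<bar>z $ i\<bar> \<le> \<bar>y $ i\<bar>"
      using continuous_attains_sup by metis
    obtain u where "u \<in> verts G" "y \<in> K u" using y by blast
    then obtain e where e: "e \<in> arcs G" "\<beta> *\<^sub>R y - a e \<in> K (head G e)"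
      using mem_attractor_iff by blast
    then have "\<beta> *\<^sub>R y - a e \<in> ?W" using head_in_verts by blast
    then have "\<bar>\<beta> * y $ i - a e $ i\<bar> \<le> \<bar>y $ i\<bar>" using max by fastforce
    moreover have "\<bar>a e $ i\<bar> \<le> of_int c"
      using translation[OF e(1)] by (auto simp: cart_power_def digits_def abs_le_iff dest!: spec[of _ i])
    moreover have "\<bar>\<beta> * y $ i\<bar> = \<beta> * \<bar>y $ i\<bar>" using beta_gt_1 by (simp add: abs_mult)
    ultimately have "(\<beta> - 1) * \<bar>y $ i\<bar> \<le> of_int c"
      unfolding left_diff_distrib by linarith
    then have "\<bar>y $ i\<bar> \<le> of_int c / (\<beta> - 1)" using beta_gt_1 by (simp add: field_simps)
    moreover have "\<bar>x $ i\<bar> \<le> \<bar>y $ i\<bar>" using max x assms by blast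
    ultimately show ?thesis by simp
  qed
  then show "x \<in> base_cube \<beta> c"
    by (simp add: base_cube_def cart_power_def abs_le_iff minus_le_iff)
qed

text \<open>The elements of \<open>P\<close> are the end points and accumulated translations of the paths of length \<open>k\<close>
  starting at \<open>u\<close>. Extending a path at its end by an arc \<open>e\<close> replaces \<open>w\<close> by \<open>a e + \<beta> w\<close>, which makes the
  new digits the constant coefficients and shifts the old ones up.\<close>

lemma attractor_unfold:
  assumes "u \<in> verts G"
  shows "\<exists>P \<subseteq> verts G \<times> cart_power (poly_values (digits c) k \<beta>).
    \<forall>x. x \<in> K u \<longleftrightarrow> (\<exists>(v, w) \<in> P. \<beta> ^ k *\<^sub>R x - w \<in> K v)"
proof (induction k)
    case 0
    have "0 \<in> cart_power (poly_values (digits c) 0 \<beta>)"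
      by (simp add: cart_power_def poly_values_def)
    then show ?case using assms by (intro exI[of _ "{(u, 0)}"]) simp
  next
    case (Suc k)
    then obtain P where P: "P \<subseteq> verts G \<times> cart_power (poly_values (digits c) k \<beta>)"
      and K_iff: "\<And>x. x \<in> K u \<longleftrightarrow> (\<exists>(v, w) \<in> P. \<beta> ^ k *\<^sub>R x - w \<in> K v)"
      by blast
    define Q where "Q = {(head G e, a e + \<beta> *\<^sub>R w) | e v w. (v, w) \<in> P \<and> e \<in> arcs G \<and> tail G e = v}"
    have "Q \<subseteq> verts G \<times> cart_power (poly_values (digits c) (Suc k) \<beta>)"
      using P translation by (fastforce simp: Q_def cart_power_def intro!: poly_values_Suc)
    moreover have "x \<in> K u \<longleftrightarrow> (\<exists>(v, w) \<in> Q. \<beta> ^ Suc k *\<^sub>R x - w \<in> K v)" for x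
    proof -
      have "\<beta> ^ k *\<^sub>R x - w \<in> K v \<longleftrightarrow> (\<exists>e \<in> arcs G. tail G e = v \<and>
          \<beta> ^ Suc k *\<^sub>R x - (a e + \<beta> *\<^sub>R w) \<in> K (head G e))" if "(v, w) \<in> P" for v w
        using that P by (subst mem_attractor_iff) (auto simp: algebra_simps)
      then show ?thesis unfolding K_iff Q_def by blast
    qed
    ultimately show ?case by blast
qed

text \<open>Every kernel set is a union of pieces \<open>(K v + t) \<inter> cube\<close> with \<open>t\<close> in a finite set of translations:
  both \<open>y\<close> and \<open>y - t\<close> lie in the base cube for a point \<open>y\<close> of the piece, so the coordinates of \<open>t\<close>
  are bounded by \<open>2 c / (\<beta> - 1)\<close>, and being differences of digit polynomials at \<open>\<beta>\<close> they fall
  under Garsia's lemma with digit bound \<open>2 c\<close>.\<close>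

lemma finite_kernel:
  assumes "pisot \<beta>" and F: "F \<subseteq> K ` verts G"
  shows "finite (kernel \<beta> c (\<Union>F))"
proof -
  define M where "M = 2 * of_int c / (\<beta> - 1)"
  define T where "T = {x \<in> (\<Union>k. poly_values (digits (c + c)) k \<beta>). \<bar>x\<bar> \<le> M}"
  define piece where "piece = (\<lambda>(v, t). {y \<in> base_cube \<beta> c. y - t \<in> K v})"
  let ?index = "verts G \<times> (cart_power T :: (real ^ 'n) set)"
  have "finite T" unfolding T_def by (rule pisot_finite_bounded_poly_values[OF assms(1)])
  then have fin: "finite ?index" by (simp add: finite_cart_power)
  have "kernel_set \<beta> c k b (\<Union>F) \<in> (\<lambda>Q. \<Union>(piece ` Q)) ` Pow ?index"
    if b: "b \<in> cart_power (poly_values (digits c) k \<beta>)" for k b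
  proof -
    obtain U where U: "U \<subseteq> verts G" "F = K ` U" using F by (meson subset_imageE)
    have "\<forall>u\<in>U. \<exists>P \<subseteq> verts G \<times> cart_power (poly_values (digits c) k \<beta>).
        \<forall>x. x \<in> K u \<longleftrightarrow> (\<exists>(v, w) \<in> P. \<beta> ^ k *\<^sub>R x - w \<in> K v)"
      using U(1) by (intro ballI) (rule attractor_unfold, auto)
    then obtain P where
      P: "\<And>u. u \<in> U \<Longrightarrow> P u \<subseteq> verts G \<times> cart_power (poly_values (digits c) k \<beta>)"
      and K_iff: "\<And>u x. u \<in> U \<Longrightarrow> x \<in> K u \<longleftrightarrow> (\<exists>(v, w) \<in> P u. \<beta> ^ k *\<^sub>R x - w \<in> K v)"
      by metis
    \<comment> \<open>Intersecting with the index set discards only translates that miss the cube.\<close>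
    define Q where "Q = {(v, w - b) | u v w. u \<in> U \<and> (v, w) \<in> P u} \<inter> ?index"
    have ne: "\<beta> ^ k \<noteq> 0" using beta_gt_1 by simp
    have in_index: "(v, w - b) \<in> ?index"
      if "(v, w) \<in> P u" "u \<in> U" "y \<in> base_cube \<beta> c" "y - (w - b) \<in> K v" for u v w y
    proof -
      have v: "v \<in> verts G" and w: "w \<in> cart_power (poly_values (digits c) k \<beta>)"
        using P that by auto
      have z: "y - (w - b) \<in> base_cube \<beta> c" using attractor_subset_base_cube[OF v] that(4) by blast
      have "(w - b) $ i \<in> T" for i
      proof -
        have "(w - b) $ i \<in> poly_values (digits (c + c)) k \<beta>"
          using b w unfolding vector_minus_component cart_power_def by (blast intro: poly_values_diff)
        moreover have "\<bar>(w - b) $ i\<bar> \<le> M"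
        proof -
          let ?r = "of_int c / (\<beta> - 1)"
          have "\<bar>y $ i\<bar> \<le> ?r" "\<bar>(y - (w - b)) $ i\<bar> \<le> ?r"
            using that(3) z by (auto simp: base_cube_def cart_power_def abs_le_iff minus_le_iff)
          then have "\<bar>(w - b) $ i\<bar> \<le> 2 * ?r" unfolding vector_minus_component by linarith
          then show ?thesis by (simp add: M_def)
        qed
        ultimately show ?thesis by (auto simp: T_def)
      qed
      then show ?thesis using v by (simp add: cart_power_def)
    qed
    have "y \<in> kernel_set \<beta> c k b (\<Union>F) \<longleftrightarrow> y \<in> \<Union>(piece ` Q)" for y
    proof -
      have img: "y \<in> (\<lambda>x. \<beta> ^ k *\<^sub>R x - b) ` A \<longleftrightarrow> (y + b) /\<^sub>R \<beta> ^ k \<in> A" for A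
      proof
        assume "(y + b) /\<^sub>R \<beta> ^ k \<in> A"
        then show "y \<in> (\<lambda>x. \<beta> ^ k *\<^sub>R x - b) ` A" by (rule rev_image_eqI) (use ne in simp)
      qed (use ne in auto)
      have rescale: "\<beta> ^ k *\<^sub>R ((y + b) /\<^sub>R \<beta> ^ k) - w = y - (w - b)" for w
        using ne by simp
      have "y \<in> kernel_set \<beta> c k b (\<Union>F) \<longleftrightarrow>
          y \<in> base_cube \<beta> c \<and> (\<exists>u\<in>U. (y + b) /\<^sub>R \<beta> ^ k \<in> K u)"
        unfolding kernel_set_def Int_iff img U(2) by blast
      also have "(\<exists>u\<in>U. (y + b) /\<^sub>R \<beta> ^ k \<in> K u) \<longleftrightarrow>
          (\<exists>u\<in>U. \<exists>(v, w) \<in> P u. \<beta> ^ k *\<^sub>R ((y + b) /\<^sub>R \<beta> ^ k) - w \<in> K v)"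
        by (intro bex_cong refl K_iff)
      also have "\<dots> \<longleftrightarrow> (\<exists>u\<in>U. \<exists>(v, w) \<in> P u. y - (w - b) \<in> K v)"
        unfolding rescale ..
      also have "y \<in> base_cube \<beta> c \<and> \<dots> \<longleftrightarrow> y \<in> \<Union>(piece ` Q)"
      proof (intro iffI; elim conjE bexE UN_E)
        fix u p assume "y \<in> base_cube \<beta> c" "u \<in> U" "p \<in> P u"
          and "case p of (v, w) \<Rightarrow> y - (w - b) \<in> K v"
        moreover obtain v w where "p = (v, w)" by fastforce
        ultimately have "(v, w - b) \<in> Q" "y \<in> piece (v, w - b)"
          using in_index unfolding piece_def Q_def by auto
        then show "y \<in> \<Union>(piece ` Q)" by blast
      next
        fix p assume "p \<in> Q" "y \<in> piece p"
        then show "y \<in> base_cube \<beta> c \<and> (\<exists>u\<in>U. \<exists>(v, w) \<in> P u. y - (w - b) \<in> K v)"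
          unfolding piece_def Q_def by auto
      qed
      finally show ?thesis .
    qed
    then have "kernel_set \<beta> c k b (\<Union>F) = \<Union>(piece ` Q)" by blast
    moreover have "Q \<in> Pow ?index" by (auto simp: Q_def)
    ultimately show ?thesis by blast
  qed
  then have "kernel \<beta> c (\<Union>F) \<subseteq> (\<lambda>Q. \<Union>(piece ` Q)) ` Pow ?index"
    unfolding kernel_def by blast
  then show ?thesis using fin by (meson finite_Pow_iff finite_imageI finite_subset)
qed

end

section \<open>Self-similarity of finite unions of attractor sets\<close>

theorem theorem62:
  fixes \<beta> :: real and c :: int
    and G :: "('v, 'e) pre_digraph"
    and S :: "'e \<Rightarrow> real ^ 'n \<Rightarrow> real ^ 'n"
    and K :: "'v \<Rightarrow> (real ^ 'n) set"
    and F :: "(real ^ 'n) set set"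
    and X :: "(real ^ 'n) set"
  assumes "pisot \<beta>" and "c \<ge> 1"
    and "gdifs G S"
    and "\<And>e. e \<in> arcs G \<Longrightarrow> \<exists>a \<in> cart_power (digits c). S e = (\<lambda>x. (x + a) /\<^sub>R \<beta>)"
    and "is_attractor G S K"
    and "finite F" and "F \<subseteq> K ` verts G" and "X = \<Union>F"
  shows "self_similar \<beta> c X"
proof -
  interpret gdifs G S by fact
  have beta: "\<beta> > 1" using assms(1) by (simp add: pisot_def)
  have "\<forall>e\<in>arcs G. \<exists>a. a \<in> cart_power (digits c) \<and> S e = (\<lambda>x. (x + a) /\<^sub>R \<beta>)"
    using assms(4) by (simp add: Bex_def)
  from bchoice[OF this] obtain a where
    a: "\<forall>e\<in>arcs G. a e \<in> cart_power (digits c) \<and> S e = (\<lambda>x. (x + a e) /\<^sub>R \<beta>)" ..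
  have compact: "compact (K v)" if "v \<in> verts G" for v
    using assms(5) that unfolding is_attractor_def by blast
  interpret digit_attractor G \<beta> c a K
  proof
    fix u x assume u: "u \<in> verts G"
    have mem_image: "x \<in> S e ` A \<longleftrightarrow> \<beta> *\<^sub>R x - a e \<in> A" if "e \<in> arcs G" for e A
    proof
      assume "x \<in> S e ` A"
      then show "\<beta> *\<^sub>R x - a e \<in> A" using beta a that by auto
    next
      assume "\<beta> *\<^sub>R x - a e \<in> A"
      then show "x \<in> S e ` A" using beta a that by (intro image_eqI) auto
    qed
    have "K u = (\<Union>v \<in> verts G. \<Union>e \<in> arcs_from_to G u v. S e ` K v)"
      using assms(5) u unfolding is_attractor_def by blast
    also have "\<dots> = (\<Union>e \<in> {e \<in> arcs G. tail G e = u}. S e ` K (head G e))"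
      unfolding arcs_from_to_def using head_in_verts by blast
    finally have "x \<in> K u \<longleftrightarrow> x \<in> (\<Union>e \<in> {e \<in> arcs G. tail G e = u}. S e ` K (head G e))"
      by (rule arg_cong)
    also have "\<dots> \<longleftrightarrow> (\<exists>e \<in> arcs G. tail G e = u \<and> \<beta> *\<^sub>R x - a e \<in> K (head G e))"
      using mem_image by auto
    finally show "x \<in> K u \<longleftrightarrow> (\<exists>e \<in> arcs G. tail G e = u \<and> \<beta> *\<^sub>R x - a e \<in> K (head G e))" .
  qed (use beta a compact in auto)
  have "compact X"
    unfolding assms(8) using assms(6,7) compact by (intro compact_Union) auto
  moreover have "X \<subseteq> base_cube \<beta> c"
    using assms(7,8) attractor_subset_base_cube by blast
  moreover have "finite (kernel \<beta> c X)"
    unfolding assms(8) by (rule finite_kernel[OF assms(1,7)])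
  ultimately show ?thesis by (simp add: self_similar_def)
qed

end
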